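(* Let $n\ge 3$ and let $\mathfrak{L}$ be a finite-dimensional Leibniz algebra over a field $\mathbb{K}$ of characteristic zero. The Leibniz $n$-algebra $\mathbf{U}_n(\mathfrak{L})$ is simple if and only if $\mathfrak{L}$ is a simple Lie algebra.
   Context: A Leibniz algebra is a vector space $\mathfrak{L}$ with a bilinear bracket satisfying $[[x,y],z]=[[x,z],y]+[x,[y,z]]$ for all $x,y,z$; it is a Lie algebra exactly when $[x,x]=0$ for all $x$. A Leibniz $n$-algebra is a vector space $L$ with an $n$-linear bracket $[-,\dots,-]$ satisfying $$[[x_1,\ldots,x_n],y_1,\ldots,y_{n-1}]=\sum_{i=1}^{n}[x_1,\ldots,x_{i-1},[x_i,y_1,\ldots,y_{n-1}],x_{i+1},\ldots,x_n].$$ For a Leibniz algebra $\mathfrak{L}$, $\mathbf{U}_n(\mathfrak{L})$ denotes the Leibniz $n$-algebra on the same vector space with bracket $[x_1,\dots,x_n]=[x_1,[\dots,[x_{n-2},[x_{n-1},x_n]]\dots]]$. An ideal of a Leibniz $n$-algebra $L$ is a subspace $I$ such that for every $1\le s\le n$ one has $[L,\dots,L,I,L,\dots,L]\subseteq I$ with $I$ in position $s$. A Leibniz $n$-algebra is abelian if its bracket is zero. A non-abelian Leibniz $n$-algebra ($n\ge3$) is called simple if its only ideals are $\{0\}$ and the $n$-algebra itself. *)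

theory Defs
  imports Complex_Main
begin

locale leibniz_algebra = vector_space scale
  for scale :: "'k::field \<Rightarrow> 'v::ab_group_add \<Rightarrow> 'v" +
  fixes bracket :: "'v \<Rightarrow> 'v \<Rightarrow> 'v"
  assumes linear_bracket_left: "Vector_Spaces.linear scale scale (\<lambda>x. bracket x y)"
    and linear_bracket_right: "Vector_Spaces.linear scale scale (\<lambda>y. bracket x y)"
    and leibniz_identity:
      "bracket (bracket x y) z = bracket (bracket x z) y + bracket x (bracket y z)"
begin

definition ideal :: "'v set \<Rightarrow> bool" where
  "ideal I \<longleftrightarrow> subspace I \<and> (\<forall>x. \<forall>a\<in>I. bracket x a \<in> I \<and> bracket a x \<in> I)"

definition abelian :: bool where
  "abelian \<longleftrightarrow> (\<forall>x y. bracket x y = 0)"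

end

locale lie_algebra = leibniz_algebra +
  assumes bracket_self: "bracket x x = 0"

locale simple_lie_algebra = lie_algebra +
  assumes not_abelian: "\<not> abelian"
    and ideal_trivial: "ideal I \<Longrightarrow> I = {0} \<or> I = UNIV"

text \<open>
  An \<open>n\<close>-ary bracket is a function on lists of which only the values at lists of length \<open>n\<close>
  matter; the argument positions are numbered from \<open>0\<close> to \<open>n - 1\<close>.
\<close>

locale leibniz_n_algebra = vector_space scale
  for scale :: "'k::field \<Rightarrow> 'v::ab_group_add \<Rightarrow> 'v" +
  fixes n :: nat
    and nbracket :: "'v list \<Rightarrow> 'v"
  assumes linear_nbracket:
      "\<lbrakk>length xs = n; i < n\<rbrakk> \<Longrightarrow> Vector_Spaces.linear scale scale (\<lambda>v. nbracket (xs[i := v]))"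
    and leibniz_n_identity:
      "\<lbrakk>length xs = n; length ys = n - 1\<rbrakk> \<Longrightarrow>
        nbracket (nbracket xs # ys) = (\<Sum>i<n. nbracket (xs[i := nbracket (xs ! i # ys)]))"
begin

definition ideal :: "'v set \<Rightarrow> bool" where
  "ideal I \<longleftrightarrow> subspace I \<and>
    (\<forall>s<n. \<forall>xs. length xs = n \<and> xs ! s \<in> I \<longrightarrow> nbracket xs \<in> I)"

definition abelian :: bool where
  "abelian \<longleftrightarrow> (\<forall>xs. length xs = n \<longrightarrow> nbracket xs = 0)"

end

locale simple_leibniz_n_algebra = leibniz_n_algebra +
  assumes not_abelian: "\<not> abelian"
    and ideal_trivial: "ideal I \<Longrightarrow> I = {0} \<or> I = UNIV"

text \<open>
  The bracket of \<open>U\<^sub>n(L)\<close>. The arity \<open>n\<close> is the length of the argument list, so a single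
  function serves all \<open>n\<close>; the value at the empty list is irrelevant.
\<close>

fun U_bracket :: "('v::zero \<Rightarrow> 'v \<Rightarrow> 'v) \<Rightarrow> 'v list \<Rightarrow> 'v" where
  "U_bracket br [] = 0"
| "U_bracket br [x] = x"
| "U_bracket br (x # y # ys) = br x (U_bracket br (y # ys))"

end

theory Submission
  imports Defs
begin

text \<open>
  Let \<open>L\<close> be a Leibniz algebra. An ideal of \<open>L\<close> is always an ideal of \<open>U\<^sub>n(L)\<close>, because an iterated
  bracket with one entry in the ideal stays in the ideal (lemma \<open>ideal_imp_n_ideal\<close>).

  Suppose that \<open>U\<^sub>n(L)\<close> is simple. The right annihilator \<open>{a. \<forall>x. [x, a] = 0}\<close> is an ideal of \<open>L\<close>,
  hence of \<open>U\<^sub>n(L)\<close>, and it contains every square \<open>[x, x]\<close>. If it were all of \<open>L\<close>, every bracket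
  would vanish; so it is \<open>{0}\<close>, which says that \<open>L\<close> is a Lie algebra. Its ideals are ideals of
  \<open>U\<^sub>n(L)\<close>, so \<open>L\<close> is simple.

  Suppose that \<open>L\<close> is a simple Lie algebra. It is perfect: \<open>[L, L]\<close> is an ideal and is not zero, so
  it is \<open>L\<close>. By induction the iterated brackets of any fixed positive number of entries span \<open>L\<close>
  (lemma \<open>span_U_bracket\<close>). For \<open>n\<close> entries this shows that \<open>U\<^sub>n(L)\<close> is not abelian. For \<open>n - 1\<close>
  entries it shows that a subspace \<open>I\<close> which absorbs \<open>n\<close>-brackets with first entry in \<open>I\<close> satisfies
  \<open>[I, L] = [I, [L, [L, \<dots>]]] \<subseteq> I\<close>; by antisymmetry an ideal of \<open>U\<^sub>n(L)\<close> is an ideal of \<open>L\<close>.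
\<close>

lemma U_bracket_Cons:
  "xs \<noteq> [] \<Longrightarrow> U_bracket br (x # xs) = br x (U_bracket br xs)"
  by (cases xs) auto

context leibniz_algebra
begin

interpretation left: Vector_Spaces.linear scale scale "\<lambda>x. bracket x y" for y
  by (rule linear_bracket_left)

interpretation right: Vector_Spaces.linear scale scale "bracket x" for x
  by (rule linear_bracket_right)

section \<open>The Leibniz n-algebra of iterated brackets\<close>

lemma linear_U_bracket:
  "i < length xs \<Longrightarrow> Vector_Spaces.linear scale scale (\<lambda>v. U_bracket bracket (xs[i := v]))"
proof (induction xs arbitrary: i)
  case Nil
  then show ?case by simp
next
  case (Cons x xs)
  show ?case
  proof (cases "xs = []")
    case True
    with Cons.prems show ?thesis
      using linear_id by (simp add: id_def)
  next
    case nonempty: False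
    show ?thesis
    proof (cases i)
      case 0
      with nonempty show ?thesis
        by (simp add: U_bracket_Cons linear_bracket_left)
    next
      case (Suc j)
      with Cons have "Vector_Spaces.linear scale scale (\<lambda>v. U_bracket bracket (xs[j := v]))"
        by simp
      from Vector_Spaces.linear_compose[OF this linear_bracket_right[of x]] nonempty Suc show ?thesis
        by (simp add: U_bracket_Cons o_def)
    qed
  qed
qed

text \<open>
  The Leibniz identity says that \<open>[-, c]\<close> is a derivation of the binary bracket; a derivation of a
  product is a derivation of all its iterates.
\<close>

lemma bracket_U_bracket_derivation:
  "xs \<noteq> [] \<Longrightarrow>
    bracket (U_bracket bracket xs) c =
      (\<Sum>i<length xs. U_bracket bracket (xs[i := bracket (xs ! i) c]))"
proof (induction xs)
  case Nil
  then show ?case by simp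
next
  case (Cons x xs)
  show ?case
  proof (cases "xs = []")
    case True
    then show ?thesis by simp
  next
    case nonempty: False
    let ?U = "U_bracket bracket"
    have "bracket (?U (x # xs)) c = bracket (bracket x c) (?U xs) + bracket x (bracket (?U xs) c)"
      using nonempty leibniz_identity[of x "?U xs" c] by (simp add: U_bracket_Cons)
    also have "bracket x (bracket (?U xs) c) =
        (\<Sum>i<length xs. bracket x (?U (xs[i := bracket (xs ! i) c])))"
      using Cons.IH[OF nonempty] by (simp add: right.sum)
    finally show ?thesis
      using nonempty by (simp add: U_bracket_Cons sum.lessThan_Suc_shift del: sum.lessThan_Suc)
  qed
qed

lemma leibniz_n_algebra_U_bracket:
  assumes "n \<ge> 2"
  shows "leibniz_n_algebra scale n (U_bracket bracket)"
proof (intro leibniz_n_algebra.intro leibniz_n_algebra_axioms.intro vector_space_axioms)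
  fix xs :: "'v list" and i
  assume "length xs = n" "i < n"
  then show "Vector_Spaces.linear scale scale (\<lambda>v. U_bracket bracket (xs[i := v]))"
    by (simp add: linear_U_bracket)
next
  fix xs ys :: "'v list"
  assume "length xs = n" "length ys = n - 1"
  with assms have "xs \<noteq> []" "ys \<noteq> []"
    by auto
  then show "U_bracket bracket (U_bracket bracket xs # ys) =
      (\<Sum>i<n. U_bracket bracket (xs[i := U_bracket bracket (xs ! i # ys)]))"
    unfolding \<open>length xs = n\<close>[symmetric] U_bracket_Cons[OF \<open>ys \<noteq> []\<close>]
    by (intro bracket_U_bracket_derivation)
qed

section \<open>Ideals\<close>

lemma U_bracket_in_ideal:
  "\<lbrakk>ideal I; s < length xs; xs ! s \<in> I\<rbrakk> \<Longrightarrow> U_bracket bracket xs \<in> I"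
proof (induction xs arbitrary: s)
  case Nil
  then show ?case by simp
next
  case (Cons x xs)
  then show ?case
    by (cases "xs = []"; cases s) (auto simp: U_bracket_Cons ideal_def)
qed

lemma ideal_imp_n_ideal:
  assumes "leibniz_n_algebra scale n (U_bracket bracket)" and "ideal I"
  shows "leibniz_n_algebra.ideal scale n (U_bracket bracket) I"
  using assms U_bracket_in_ideal
  by (auto simp: leibniz_n_algebra.ideal_def ideal_def)

lemma abelian_imp_n_abelian:
  assumes "leibniz_n_algebra scale n (U_bracket bracket)" and "n \<ge> 2" and "abelian"
  shows "leibniz_n_algebra.abelian n (U_bracket bracket)"
proof -
  have "U_bracket bracket xs = 0" if "length xs = n" for xs
    using that assms(2,3) by (cases xs; cases "tl xs") (auto simp: abelian_def)
  with assms(1) show ?thesis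
    by (simp add: leibniz_n_algebra.abelian_def)
qed

text \<open>
  Closure of the right annihilator under brackets from the right comes from the Leibniz identity in
  the form \<open>[y, [a, x]] = [[y, a], x] - [[y, x], a]\<close>, in which \<open>a\<close> stands in the right entry of
  both terms.
\<close>

lemma ideal_right_annihilator: "ideal {a. \<forall>x. bracket x a = 0}"
proof -
  have "bracket y (bracket a x) = 0" if "\<forall>x. bracket x a = 0" for a x y
    using leibniz_identity[of y a x] that by (simp add: left.zero)
  then show ?thesis
    by (auto simp: ideal_def subspace_def right.zero right.add right.scale)
qed

text \<open>
  The Leibniz identity with two equal right entries: the term \<open>[[x, y], y]\<close> occurs on
  both sides and cancels.
\<close>

lemma square_in_right_annihilator: "bracket x (bracket y y) = 0"
  using leibniz_identity[of x y y] by simp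

lemma ideal_derived_algebra: "ideal (span {bracket x y |x y. True})"
  by (auto simp: ideal_def intro: span_base)

section \<open>Perfect Leibniz algebras\<close>

text \<open>
  The iterated brackets of \<open>k + 1\<close> entries are the products \<open>[x, u]\<close> with \<open>u\<close> an iterated bracket of
  \<open>k\<close> entries. If such \<open>u\<close> span \<open>L\<close>, then by linearity the products span \<open>[L, L] = L\<close>.
\<close>

lemma span_U_bracket:
  assumes perfect: "span {bracket x y |x y. True} = UNIV"
  shows "k \<ge> 1 \<Longrightarrow> span (U_bracket bracket ` {xs. length xs = k}) = UNIV"
proof (induction k rule: nat_induct_at_least)
  case base
  have "x \<in> U_bracket bracket ` {xs. length xs = 1}" for x
    by (rule image_eqI[of _ _ "[x]"]) simp_all
  then show ?case
    by (metis UNIV_eq_I span_base)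
next
  case (Suc k)
  let ?S = "\<lambda>k. U_bracket bracket ` {xs. length xs = k}"
  have "bracket x y \<in> span (?S (Suc k))" for x y
  proof -
    have "bracket x ` ?S k \<subseteq> ?S (Suc k)"
    proof clarify
      fix xs :: "'v list"
      assume "k = length xs"
      with Suc.hyps have "xs \<noteq> []" by auto
      then show "bracket x (U_bracket bracket xs) \<in> ?S (Suc (length xs))"
        by (intro image_eqI[of _ _ "x # xs"]) (auto simp: U_bracket_Cons)
    qed
    moreover have "bracket x y \<in> span (bracket x ` ?S k)"
      using Suc.IH by (simp add: right.span_image)
    ultimately show ?thesis
      using span_mono by blast
  qed
  then have "span {bracket x y |x y. True} \<subseteq> span (?S (Suc k))"
    by (intro span_minimal subspace_span) auto
  with perfect show ?case by auto
qed

lemma n_abelian_imp_abelian: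
  assumes "leibniz_n_algebra scale n (U_bracket bracket)" and "n \<ge> 1"
    and "span {bracket x y |x y. True} = UNIV"
    and "leibniz_n_algebra.abelian n (U_bracket bracket)"
  shows "abelian"
proof -
  have "U_bracket bracket ` {xs. length xs = n} \<subseteq> {0}"
    using assms(1,4) by (auto simp: leibniz_n_algebra.abelian_def)
  then have "span (U_bracket bracket ` {xs. length xs = n}) \<subseteq> {0}"
    by (metis span_mono span_insert_0 span_empty)
  with span_U_bracket[OF assms(3,2)] show ?thesis
    by (auto simp: abelian_def)
qed

text \<open>
  The element \<open>y\<close> is a linear combination of iterated brackets of \<open>n - 1\<close> entries, so \<open>[a, y]\<close> is one
  of \<open>n\<close>-brackets whose first entry is \<open>a\<close>.
\<close>

lemma bracket_n_ideal_left:
  assumes n_algebra: "leibniz_n_algebra scale n (U_bracket bracket)" and "n \<ge> 2"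
    and perfect: "span {bracket x y |x y. True} = UNIV"
    and I: "leibniz_n_algebra.ideal scale n (U_bracket bracket) I" and "a \<in> I"
  shows "bracket a y \<in> I"
proof -
  let ?S = "U_bracket bracket ` {xs. length xs = n - 1}"
  have "subspace I"
    using I n_algebra by (simp add: leibniz_n_algebra.ideal_def)
  have "bracket a (U_bracket bracket xs) \<in> I" if "length xs = n - 1" for xs
  proof -
    have "length (a # xs) = n" "(a # xs) ! 0 \<in> I" "0 < n" "xs \<noteq> []"
      using that \<open>n \<ge> 2\<close> \<open>a \<in> I\<close> by auto
    with I n_algebra have "U_bracket bracket (a # xs) \<in> I"
      unfolding leibniz_n_algebra.ideal_def[OF n_algebra] by blast
    with \<open>xs \<noteq> []\<close> show ?thesis
      by (simp add: U_bracket_Cons)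
  qed
  then have "span (bracket a ` ?S) \<subseteq> I"
    using \<open>subspace I\<close> by (intro span_minimal) auto
  moreover have "bracket a y \<in> span (bracket a ` ?S)"
    using span_U_bracket[OF perfect, of "n - 1"] \<open>n \<ge> 2\<close> by (simp add: right.span_image)
  ultimately show ?thesis by blast
qed

end

lemma (in lie_algebra) bracket_antisym: "bracket x y = - bracket y x"
proof -
  interpret left: Vector_Spaces.linear scale scale "\<lambda>u. bracket u v" for v
    by (rule linear_bracket_left)
  interpret right: Vector_Spaces.linear scale scale "bracket u" for u
    by (rule linear_bracket_right)
  have "bracket (x + y) (x + y) = bracket x y + bracket y x"
    by (simp only: left.add right.add) (simp add: bracket_self)
  then have "bracket x y + bracket y x = 0"
    using bracket_self[of "x + y"] by (rule trans[OF sym])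
  then show ?thesis
    by (simp add: eq_neg_iff_add_eq_0)
qed

lemma (in simple_lie_algebra) perfect: "span {bracket x y |x y. True} = UNIV"
proof -
  have "span {bracket x y |x y. True} \<noteq> {0}"
    using not_abelian by (auto simp: abelian_def intro: span_base)
  with ideal_trivial[OF ideal_derived_algebra] show ?thesis by blast
qed

section \<open>Simplicity\<close>

lemma (in leibniz_algebra) simple_lie_algebra_if_simple_n_algebra:
  assumes "n \<ge> 2" and "simple_leibniz_n_algebra scale n (U_bracket bracket)"
  shows "simple_lie_algebra scale bracket"
proof -
  interpret U: simple_leibniz_n_algebra scale n "U_bracket bracket" by fact
  note U_algebra = U.leibniz_n_algebra_axioms
  have trivial: "I = {0} \<or> I = UNIV" if "ideal I" for I
    using U.ideal_trivial ideal_imp_n_ideal[OF U_algebra that] .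
  have "\<not> abelian"
    using abelian_imp_n_abelian[OF U_algebra \<open>n \<ge> 2\<close>] U.not_abelian by blast
  then have "{a. \<forall>x. bracket x a = 0} \<noteq> UNIV"
    by (auto simp: abelian_def)
  with trivial[OF ideal_right_annihilator] have "{a. \<forall>x. bracket x a = 0} = {0}"
    by blast
  then have "bracket x x = 0" for x
    using square_in_right_annihilator by blast
  with \<open>\<not> abelian\<close> trivial show ?thesis
    by unfold_locales auto
qed

lemma (in simple_lie_algebra) simple_n_algebra_U_bracket:
  assumes "n \<ge> 2"
  shows "simple_leibniz_n_algebra scale n (U_bracket bracket)"
proof -
  interpret U: leibniz_n_algebra scale n "U_bracket bracket"
    by (rule leibniz_n_algebra_U_bracket[OF assms])
  note U_algebra = U.leibniz_n_algebra_axioms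
  have n_ideal: "ideal I" if I: "U.ideal I" for I
  proof -
    have "subspace I"
      using I by (simp add: U.ideal_def)
    moreover have "bracket a x \<in> I" if "a \<in> I" for a x
      using bracket_n_ideal_left[OF U_algebra assms perfect I that] .
    moreover from calculation have "bracket x a \<in> I" if "a \<in> I" for a x
      using that by (subst bracket_antisym) (simp add: subspace_neg)
    ultimately show ?thesis
      by (simp add: ideal_def)
  qed
  show ?thesis
  proof unfold_locales
    show "\<not> U.abelian"
      using n_abelian_imp_abelian[OF U_algebra _ perfect] not_abelian assms by auto
    show "I = {0} \<or> I = UNIV" if "U.ideal I" for I
      by (rule ideal_trivial[OF n_ideal[OF that]])
  qed
qed

theorem theorem3p8:
  fixes scale :: "'k::field_char_0 \<Rightarrow> 'v::ab_group_add \<Rightarrow> 'v"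
    and bracket :: "'v \<Rightarrow> 'v \<Rightarrow> 'v"
    and Basis :: "'v set"
    and n :: nat
  assumes "n \<ge> 3"
    and "finite_dimensional_vector_space scale Basis"
    and "leibniz_algebra scale bracket"
  shows "simple_leibniz_n_algebra scale n (U_bracket bracket) \<longleftrightarrow>
         simple_lie_algebra scale bracket"
proof -
  have "n \<ge> 2" using \<open>n \<ge> 3\<close> by simp
  then show ?thesis
    using leibniz_algebra.simple_lie_algebra_if_simple_n_algebra[OF assms(3)]
      simple_lie_algebra.simple_n_algebra_U_bracket by blast
qed

end
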